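(* Let $\Gamma$ be a finitely generated group. If $\Gamma$ does not have property $R_\infty$, then the canonical action of $\mathrm{Aut}(\Gamma)$ on the first integral cohomology $H^1(\Gamma)=H^1(\Gamma,\mathbb{Z})$ (trivial coefficients) does not admit nonzero global fixed points.
   Context: For $\varphi\in\mathrm{Aut}(\Gamma)$, the Reidemeister number $R(\varphi)$ is the number of orbits of the $\varphi$-twisted conjugation action $\Gamma\times\Gamma\to\Gamma$, $(g,a)\mapsto g\,a\,\varphi(g)^{-1}$. $\Gamma$ has property $R_\infty$ if $R(\varphi)=\infty$ for every $\varphi\in\mathrm{Aut}(\Gamma)$. Under the canonical identification $H^1(\Gamma,\mathbb{Z})\cong\mathrm{Hom}(\Gamma,\mathbb{Z})$, the canonical action of $\mathrm{Aut}(\Gamma)$ is $(\varphi,f)\mapsto f\circ\varphi^{-1}$. A global fixed point of an action of a group $H$ on a set $X$ is an $x\in X$ with $h(x)=x$ for all $h\in H$. *)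

theory Defs
  imports "HOL-Algebra.Group_Action" "HOL-Algebra.Elementary_Groups" "HOL-Library.Extended_Nat"
begin

definition finitely_generated :: "('a, 'b) monoid_scheme \<Rightarrow> bool" where
  "finitely_generated G \<longleftrightarrow> (\<exists>S. finite S \<and> S \<subseteq> carrier G \<and> generate G S = carrier G)"

definition global_fixed_point ::
  "('h, 'c) monoid_scheme \<Rightarrow> 'x set \<Rightarrow> ('h \<Rightarrow> 'x \<Rightarrow> 'x) \<Rightarrow> 'x \<Rightarrow> bool" where
  "global_fixed_point H X \<alpha> x \<longleftrightarrow> x \<in> X \<and> (\<forall>h\<in>carrier H. \<alpha> h x = x)"


section \<open>Twisted conjugation and Reidemeister numbers\<close>

text \<open>
  Automorphisms are the elements of \<^const>\<open>auto\<close>. These are extensional functions, so that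
  distinct elements of \<^term>\<open>auto G\<close> are distinct as automorphisms of \<^term>\<open>G\<close>.
\<close>

definition twisted_conjugation ::
  "('a, 'b) monoid_scheme \<Rightarrow> ('a \<Rightarrow> 'a) \<Rightarrow> 'a \<Rightarrow> 'a \<Rightarrow> 'a" where
  "twisted_conjugation G \<phi> g = (\<lambda>a\<in>carrier G. g \<otimes>\<^bsub>G\<^esub> a \<otimes>\<^bsub>G\<^esub> inv\<^bsub>G\<^esub> (\<phi> g))"

definition reidemeister_number :: "('a, 'b) monoid_scheme \<Rightarrow> ('a \<Rightarrow> 'a) \<Rightarrow> enat" where
  "reidemeister_number G \<phi> =
     (let Orb = orbits G (carrier G) (twisted_conjugation G \<phi>)
      in if finite Orb then enat (card Orb) else \<infinity>)"

definition property_R_infinity :: "('a, 'b) monoid_scheme \<Rightarrow> bool" where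
  "property_R_infinity G \<longleftrightarrow> (\<forall>\<phi>\<in>auto G. reidemeister_number G \<phi> = \<infinity>)"

lemma (in group) twisted_conjugation_action:
  assumes "\<phi> \<in> auto G"
  shows "group_action G (carrier G) (twisted_conjugation G \<phi>)"
proof -
  interpret \<phi>: group_hom G G \<phi>
    using assms by unfold_locales (auto simp: auto_def)
  have bij: "twisted_conjugation G \<phi> g \<in> Bij (carrier G)" if g: "g \<in> carrier G" for g
  proof -
    have [simp]: "x \<otimes> inv u \<otimes> u = x" "x \<otimes> u \<otimes> inv u = x"
      if "x \<in> carrier G" "u \<in> carrier G" for x u
      using that by (simp_all add: m_assoc)
    have "bij_betw (\<lambda>a. g \<otimes> a \<otimes> inv (\<phi> g)) (carrier G) (carrier G)"
      using g by (intro bij_betwI[where g = "\<lambda>a. inv g \<otimes> a \<otimes> \<phi> g"])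
        (auto simp: m_assoc[symmetric] g)
    then show ?thesis
      by (simp add: Bij_def twisted_conjugation_def cong: bij_betw_cong)
  qed
  have "twisted_conjugation G \<phi> (g \<otimes> h)
      = compose (carrier G) (twisted_conjugation G \<phi> g) (twisted_conjugation G \<phi> h)"
    if "g \<in> carrier G" "h \<in> carrier G" for g h
    using that by (auto simp: twisted_conjugation_def compose_def inv_mult_group m_assoc)
  with bij have "twisted_conjugation G \<phi> \<in> hom G (BijGroup (carrier G))"
    by (auto simp: hom_def BijGroup_def)
  then show ?thesis
    by (simp add: group_action_def group_hom_def group_hom_axioms_def group_BijGroup is_group)
qed


section \<open>First integral cohomology\<close>

text \<open>
  The inhomogeneous cochain description of group cohomology in degree one, with coefficients
  in the integers on which \<open>G\<close> acts by \<open>\<rho>\<close>. Cochains are extensional functions on the carrier.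
\<close>

definition cocycles1 :: "('a, 'b) monoid_scheme \<Rightarrow> ('a \<Rightarrow> int \<Rightarrow> int) \<Rightarrow> ('a \<Rightarrow> int) set" where
  "cocycles1 G \<rho> = {f \<in> extensional (carrier G).
     \<forall>g\<in>carrier G. \<forall>h\<in>carrier G. f (g \<otimes>\<^bsub>G\<^esub> h) = f g + \<rho> g (f h)}"

definition coboundaries1 :: "('a, 'b) monoid_scheme \<Rightarrow> ('a \<Rightarrow> int \<Rightarrow> int) \<Rightarrow> ('a \<Rightarrow> int) set" where
  "coboundaries1 G \<rho> = range (\<lambda>m. \<lambda>g\<in>carrier G. \<rho> g m - m)"

definition cocycle_group1 ::
  "('a, 'b) monoid_scheme \<Rightarrow> ('a \<Rightarrow> int \<Rightarrow> int) \<Rightarrow> ('a \<Rightarrow> int) monoid" where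
  "cocycle_group1 G \<rho> = \<lparr>carrier = cocycles1 G \<rho>,
     mult = (\<lambda>f f'. \<lambda>g\<in>carrier G. f g + f' g), one = (\<lambda>g\<in>carrier G. 0)\<rparr>"

abbreviation trivial_coeff :: "'a \<Rightarrow> int \<Rightarrow> int" where
  "trivial_coeff \<equiv> \<lambda>g m. m"

definition H1 :: "('a, 'b) monoid_scheme \<Rightarrow> ('a \<Rightarrow> int) set monoid" where
  "H1 G = cocycle_group1 G trivial_coeff Mod coboundaries1 G trivial_coeff"

text \<open>The class of \<open>f\<close> is sent to the class of \<open>f \<circ> \<phi>\<inverse>\<close>; classes are sets of cocycles.\<close>

definition H1_action ::
  "('a, 'b) monoid_scheme \<Rightarrow> ('a \<Rightarrow> 'a) \<Rightarrow> ('a \<Rightarrow> int) set \<Rightarrow> ('a \<Rightarrow> int) set" where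
  "H1_action G \<phi> = (\<lambda>c\<in>carrier (H1 G).
     (\<lambda>f. compose (carrier G) f (inv\<^bsub>AutoGroup G\<^esub> \<phi>)) ` c)"


subsection \<open>Identification with homomorphisms to the integers\<close>

definition Hom_int :: "('a, 'b) monoid_scheme \<Rightarrow> ('a \<Rightarrow> int) monoid" where
  "Hom_int G = \<lparr>carrier = hom G integer_group \<inter> extensional (carrier G),
     mult = (\<lambda>f f'. \<lambda>g\<in>carrier G. f g + f' g), one = (\<lambda>g\<in>carrier G. 0)\<rparr>"

definition H1_class :: "('a, 'b) monoid_scheme \<Rightarrow> ('a \<Rightarrow> int) \<Rightarrow> ('a \<Rightarrow> int) set" where
  "H1_class G f = coboundaries1 G trivial_coeff #>\<^bsub>cocycle_group1 G trivial_coeff\<^esub> f"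

lemma cocycle_group1_trivial: "cocycle_group1 G trivial_coeff = Hom_int G"
  by (auto simp: cocycle_group1_def Hom_int_def cocycles1_def hom_def integer_group_def)

lemma coboundaries1_trivial: "coboundaries1 G trivial_coeff = {\<one>\<^bsub>Hom_int G\<^esub>}"
  by (auto simp: coboundaries1_def Hom_int_def)

lemma (in group) comm_group_Hom_int: "comm_group (Hom_int G)"
proof (rule comm_groupI)
  fix f assume f: "f \<in> carrier (Hom_int G)"
  then show "\<exists>f'\<in>carrier (Hom_int G). f' \<otimes>\<^bsub>Hom_int G\<^esub> f = \<one>\<^bsub>Hom_int G\<^esub>"
    by (intro bexI[where x = "\<lambda>g\<in>carrier G. - f g"])
      (auto simp: Hom_int_def hom_def integer_group_def fun_eq_iff)
  show "\<one>\<^bsub>Hom_int G\<^esub> \<otimes>\<^bsub>Hom_int G\<^esub> f = f"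
    using f by (auto simp: Hom_int_def fun_eq_iff extensional_def)
qed (auto simp: Hom_int_def hom_def integer_group_def fun_eq_iff)

lemma (in group) H1_class_eq: "f \<in> carrier (Hom_int G) \<Longrightarrow> H1_class G f = {f}"
  using comm_group.axioms(2)[OF comm_group_Hom_int]
  by (simp add: H1_class_def cocycle_group1_trivial coboundaries1_trivial r_coset_def
      group.is_monoid monoid.l_one)

lemma (in group) H1_class_iso: "H1_class G \<in> iso (Hom_int G) (H1 G)"
proof -
  interpret H: comm_group "Hom_int G" by (rule comm_group_Hom_int)
  interpret N: normal "{\<one>\<^bsub>Hom_int G\<^esub>}" "Hom_int G"
    by (rule H.one_is_normal)
  have "H1_class G \<in> hom (Hom_int G) (H1 G)"
    using N.r_coset_hom_Mod
    by (simp add: H1_def H1_class_def[abs_def] cocycle_group1_trivial coboundaries1_trivial)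
  moreover have "bij_betw (H1_class G) (carrier (Hom_int G)) (carrier (H1 G))"
    unfolding bij_betw_def
  proof
    show "inj_on (H1_class G) (carrier (Hom_int G))"
      by (auto simp: inj_on_def H1_class_eq)
    show "H1_class G ` carrier (Hom_int G) = carrier (H1 G)"
      by (simp add: H1_def H1_class_def cocycle_group1_trivial coboundaries1_trivial
          carrier_FactGroup)
  qed
  ultimately show ?thesis by (simp add: iso_def)
qed

lemma (in group) compose_auto_Hom_int:
  assumes "f \<in> carrier (Hom_int G)" "\<psi> \<in> auto G"
  shows "compose (carrier G) f \<psi> \<in> carrier (Hom_int G)"
proof -
  have "\<psi> \<in> hom G G" using assms by (simp add: auto_def)
  with assms(1) show ?thesis
    by (auto simp: Hom_int_def hom_def integer_group_def compose_def Pi_iff)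
qed

lemma (in group) carrier_AutoGroup: "carrier (AutoGroup G) = auto G"
  by (simp add: AutoGroup_def)

lemma (in group) inv_auto: "\<phi> \<in> auto G \<Longrightarrow> inv\<^bsub>AutoGroup G\<^esub> \<phi> \<in> auto G"
  using group.inv_closed[OF AutoGroup] by (simp add: carrier_AutoGroup)

lemma (in group) H1_action_class:
  assumes "f \<in> carrier (Hom_int G)" "\<phi> \<in> auto G"
  shows "H1_action G \<phi> (H1_class G f)
       = H1_class G (compose (carrier G) f (inv\<^bsub>AutoGroup G\<^esub> \<phi>))"
proof -
  have "H1_class G f \<in> carrier (H1 G)"
    using H1_class_iso assms(1) by (auto simp: iso_def bij_betw_def)
  then show ?thesis
    using assms by (simp add: H1_action_def H1_class_eq compose_auto_Hom_int inv_auto)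
qed

lemma (in group) H1_group_action: "group_action (AutoGroup G) (carrier (H1 G)) (H1_action G)"
proof -
  interpret A: group "AutoGroup G" by (rule AutoGroup)
  let ?E = "carrier (H1 G)"
  have E: "?E = H1_class G ` carrier (Hom_int G)"
    using H1_class_iso by (auto simp: iso_def bij_betw_def)
  have one: "H1_action G \<one>\<^bsub>AutoGroup G\<^esub> c = c" if c: "c \<in> ?E" for c
  proof -
    obtain f where f: "f \<in> carrier (Hom_int G)" "c = H1_class G f" using c E by auto
    have "compose (carrier G) f \<one>\<^bsub>AutoGroup G\<^esub> = f"
      using f(1) by (auto simp: AutoGroup_def BijGroup_def Hom_int_def compose_def
          extensional_def fun_eq_iff)
    then show ?thesis
      using f H1_action_class[OF f(1), of "\<one>\<^bsub>AutoGroup G\<^esub>"] A.one_closed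
      by (simp add: carrier_AutoGroup)
  qed
  have closed: "H1_action G \<phi> c \<in> ?E" if "c \<in> ?E" "\<phi> \<in> auto G" for \<phi> c
    using that E by (auto simp: H1_action_class compose_auto_Hom_int inv_auto)
  have comp: "H1_action G (\<phi> \<otimes>\<^bsub>AutoGroup G\<^esub> \<psi>) c = H1_action G \<phi> (H1_action G \<psi> c)"
    if c: "c \<in> ?E" and p: "\<phi> \<in> auto G" "\<psi> \<in> auto G" for \<phi> \<psi> c
  proof -
    obtain f where f: "f \<in> carrier (Hom_int G)" "c = H1_class G f" using c E by auto
    let ?i = "\<lambda>\<phi>. inv\<^bsub>AutoGroup G\<^esub> \<phi>"
    have mult: "\<alpha> \<otimes>\<^bsub>AutoGroup G\<^esub> \<beta> = compose (carrier G) \<alpha> \<beta>"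
      if "\<alpha> \<in> auto G" "\<beta> \<in> auto G" for \<alpha> \<beta>
      using that by (simp add: AutoGroup_def BijGroup_def auto_def)
    have "?i (\<phi> \<otimes>\<^bsub>AutoGroup G\<^esub> \<psi>) = compose (carrier G) (?i \<psi>) (?i \<phi>)"
      using p A.inv_mult_group[of \<phi> \<psi>]
      by (simp add: carrier_AutoGroup inv_auto flip: mult)
    moreover have "?i \<phi> \<in> carrier G \<rightarrow> carrier G"
      using inv_auto[OF p(1)] by (auto simp: auto_def hom_def)
    ultimately have "compose (carrier G) f (?i (\<phi> \<otimes>\<^bsub>AutoGroup G\<^esub> \<psi>))
        = compose (carrier G) (compose (carrier G) f (?i \<psi>)) (?i \<phi>)"
      by (simp add: compose_assoc)
    moreover have "\<phi> \<otimes>\<^bsub>AutoGroup G\<^esub> \<psi> \<in> auto G"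
      using p A.m_closed by (simp add: carrier_AutoGroup)
    ultimately show ?thesis
      using f p by (simp add: H1_action_class compose_auto_Hom_int inv_auto)
  qed
  have bij: "H1_action G \<phi> \<in> Bij ?E" if p: "\<phi> \<in> auto G" for \<phi>
  proof -
    have "bij_betw (H1_action G \<phi>) ?E ?E"
    proof (rule bij_betwI[where g = "H1_action G (inv\<^bsub>AutoGroup G\<^esub> \<phi>)"])
      fix c assume c: "c \<in> ?E"
      show "H1_action G (inv\<^bsub>AutoGroup G\<^esub> \<phi>) (H1_action G \<phi> c) = c"
        using comp[OF c inv_auto[OF p] p] one[OF c] p by (simp add: carrier_AutoGroup A.l_inv)
      show "H1_action G \<phi> (H1_action G (inv\<^bsub>AutoGroup G\<^esub> \<phi>) c) = c"
        using comp[OF c p inv_auto[OF p]] one[OF c] p by (simp add: carrier_AutoGroup A.r_inv)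
    qed (use closed p inv_auto in auto)
    then show ?thesis by (simp add: Bij_def H1_action_def)
  qed
  have "H1_action G (\<phi> \<otimes>\<^bsub>AutoGroup G\<^esub> \<psi>) = compose ?E (H1_action G \<phi>) (H1_action G \<psi>)"
    if "\<phi> \<in> auto G" "\<psi> \<in> auto G" for \<phi> \<psi>
  proof
    fix c show "H1_action G (\<phi> \<otimes>\<^bsub>AutoGroup G\<^esub> \<psi>) c = compose ?E (H1_action G \<phi>) (H1_action G \<psi>) c"
      using comp[OF _ that] by (cases "c \<in> ?E") (simp_all add: compose_def H1_action_def)
  qed
  with bij have "H1_action G \<in> hom (AutoGroup G) (BijGroup ?E)"
    by (auto simp: hom_def BijGroup_def carrier_AutoGroup)
  then show ?thesis
    by (simp add: group_action_def group_hom_def group_hom_axioms_def group_BijGroup AutoGroup)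
qed

end

theory Submission
  imports Defs
begin

text \<open>
  A class in \<open>H\<^sup>1(\<Gamma>)\<close> is a homomorphism \<open>f\<close> from \<open>\<Gamma>\<close> to the integers, and it is a global fixed
  point exactly if \<open>f \<circ> \<phi> = f\<close> for every automorphism \<open>\<phi>\<close>. For such \<open>f\<close> and \<open>\<phi>\<close>,
  \<open>f (g \<otimes> a \<otimes> inv (\<phi> g)) = f g + f a - f (\<phi> g) = f a\<close>, the integers being abelian, so \<open>f\<close> is an
  invariant of twisted conjugacy classes. If \<open>f\<close> is nonzero it takes infinitely
  many values, since its image is a nonzero subgroup of the integers; hence there are infinitely
  many \<open>\<phi>\<close>-twisted conjugacy classes. A nonzero global fixed point thus gives \<open>R(\<phi>) = \<infinity>\<close>
  for all \<open>\<phi>\<close> at once.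
\<close>

lemma (in group) infinite_image_nonzero_hom_int:
  assumes f: "f \<in> hom G integer_group" and x: "x \<in> carrier G" "f x \<noteq> 0"
  shows "infinite (f ` carrier G)"
proof -
  interpret f: group_hom G integer_group f
    using f by (simp add: group_hom_def group_hom_axioms_def)
  have pow: "f (x [^] n) = int n * f x" for n :: nat
    by (induction n) (use x f f.hom_one in \<open>auto simp: hom_def algebra_simps\<close>)
  have "inj (\<lambda>n::nat. f (x [^] n))"
    using x by (auto simp: inj_def pow)
  then have "infinite (range (\<lambda>n::nat. f (x [^] n)))"
    by (simp add: finite_image_iff)
  moreover have "range (\<lambda>n::nat. f (x [^] n)) \<subseteq> f ` carrier G"
    using x by auto
  ultimately show ?thesis
    using finite_subset by blast
qed

lemma (in group) invariant_hom_int_twisted_conjugation: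
  assumes f: "f \<in> hom G integer_group"
    and \<phi>: "\<phi> \<in> auto G"
    and inv: "\<And>g. g \<in> carrier G \<Longrightarrow> f (\<phi> g) = f g"
    and g: "g \<in> carrier G" and a: "a \<in> carrier G"
  shows "f (twisted_conjugation G \<phi> g a) = f a"
proof -
  interpret f: group_hom G integer_group f
    using f by (simp add: group_hom_def group_hom_axioms_def)
  have \<phi>g: "\<phi> g \<in> carrier G"
    using \<phi> g by (auto simp: auto_def hom_def)
  then show ?thesis
    using f.hom_inv[OF \<phi>g] g a by (simp add: twisted_conjugation_def inv)
qed

text \<open>
  An invariant of twisted conjugacy classes that takes infinitely many values separates
  infinitely many of them.
\<close>

lemma (in group) reidemeister_number_infinite_if_invariant_hom_int:
  assumes f: "f \<in> hom G integer_group"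
    and \<phi>: "\<phi> \<in> auto G"
    and inv: "\<And>g. g \<in> carrier G \<Longrightarrow> f (\<phi> g) = f g"
    and x: "x \<in> carrier G" "f x \<noteq> 0"
  shows "reidemeister_number G \<phi> = \<infinity>"
proof -
  let ?Orb = "orbits G (carrier G) (twisted_conjugation G \<phi>)"
  interpret action: group_action G "carrier G" "twisted_conjugation G \<phi>"
    by (rule twisted_conjugation_action[OF \<phi>])
  have "f ` X = {f a}" if "a \<in> carrier G" "X = orbit G (twisted_conjugation G \<phi>) a" for a X
    using that action.orbit_refl[of a] invariant_hom_int_twisted_conjugation[OF f \<phi> inv]
    by (auto simp: orbit_def)
  then have single: "finite (f ` X)" if "X \<in> ?Orb" for X
    using that by (fastforce simp: orbits_def)
  have cover: "f ` carrier G = (\<Union>X\<in>?Orb. f ` X)"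
    using action.orbits_coverture by blast
  have "infinite ?Orb"
  proof
    assume "finite ?Orb"
    with single have "finite (f ` carrier G)"
      unfolding cover by blast
    with infinite_image_nonzero_hom_int[OF f x] show False by contradiction
  qed
  then show ?thesis
    by (simp add: reidemeister_number_def)
qed

lemma (in group) H1_global_fixed_point_invariant:
  assumes f: "f \<in> carrier (Hom_int G)"
    and fixed: "global_fixed_point (AutoGroup G) (carrier (H1 G)) (H1_action G) (H1_class G f)"
    and \<phi>: "\<phi> \<in> auto G" and g: "g \<in> carrier G"
  shows "f (\<phi> g) = f g"
proof -
  interpret A: group "AutoGroup G" by (rule AutoGroup)
  \<comment> \<open>The action precomposes with inverses, so \<open>f \<circ> \<phi>\<close> is the translate of \<open>f\<close> by \<open>\<phi>\<inverse>\<close>.\<close>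
  let ?\<psi> = "inv\<^bsub>AutoGroup G\<^esub> \<phi>"
  have \<psi>: "?\<psi> \<in> auto G" "inv\<^bsub>AutoGroup G\<^esub> ?\<psi> = \<phi>"
    using \<phi> by (simp_all add: inv_auto carrier_AutoGroup)
  have "H1_action G ?\<psi> (H1_class G f) = H1_class G f"
    using fixed \<psi>(1) by (simp add: global_fixed_point_def carrier_AutoGroup)
  then have "H1_class G (compose (carrier G) f \<phi>) = H1_class G f"
    using H1_action_class[OF f \<psi>(1)] \<psi>(2) by simp
  then have "compose (carrier G) f \<phi> = f"
    using f \<phi> by (simp add: H1_class_eq compose_auto_Hom_int)
  with g show ?thesis
    by (metis compose_eq)
qed

theorem theorem1p3:
  fixes \<Gamma> :: "('a, 'b) monoid_scheme"
  assumes "group \<Gamma>"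
    and "finitely_generated \<Gamma>"
    and "\<not> property_R_infinity \<Gamma>"
  shows "\<not> (\<exists>c\<in>carrier (H1 \<Gamma>). c \<noteq> \<one>\<^bsub>H1 \<Gamma>\<^esub>
           \<and> global_fixed_point (AutoGroup \<Gamma>) (carrier (H1 \<Gamma>)) (H1_action \<Gamma>) c)"
proof
  interpret group \<Gamma> by (rule assms(1))
  assume "\<exists>c\<in>carrier (H1 \<Gamma>). c \<noteq> \<one>\<^bsub>H1 \<Gamma>\<^esub>
           \<and> global_fixed_point (AutoGroup \<Gamma>) (carrier (H1 \<Gamma>)) (H1_action \<Gamma>) c"
  then obtain c where c: "c \<in> carrier (H1 \<Gamma>)" "c \<noteq> \<one>\<^bsub>H1 \<Gamma>\<^esub>"
    and fixed: "global_fixed_point (AutoGroup \<Gamma>) (carrier (H1 \<Gamma>)) (H1_action \<Gamma>) c"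
    by blast
  obtain f where f: "f \<in> carrier (Hom_int \<Gamma>)" and cf: "c = H1_class \<Gamma> f"
    using c(1) H1_class_iso by (auto simp: iso_def bij_betw_def)
  have "\<one>\<^bsub>H1 \<Gamma>\<^esub> = {\<one>\<^bsub>Hom_int \<Gamma>\<^esub>}"
    by (simp add: H1_def FactGroup_def cocycle_group1_trivial coboundaries1_trivial)
  with c(2) f have "f \<noteq> (\<lambda>g\<in>carrier \<Gamma>. 0)"
    by (auto simp: cf H1_class_eq Hom_int_def)
  moreover have hom: "f \<in> hom \<Gamma> integer_group" and "f \<in> extensional (carrier \<Gamma>)"
    using f by (simp_all add: Hom_int_def)
  ultimately obtain x where x: "x \<in> carrier \<Gamma>" "f x \<noteq> 0"
    by (metis extensionalityI restrict_apply' restrict_extensional)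
  have "reidemeister_number \<Gamma> \<phi> = \<infinity>" if \<phi>: "\<phi> \<in> auto \<Gamma>" for \<phi>
    using H1_global_fixed_point_invariant[OF f fixed[unfolded cf] \<phi>]
    by (intro reidemeister_number_infinite_if_invariant_hom_int[OF hom \<phi> _ x])
  then have "property_R_infinity \<Gamma>"
    by (simp add: property_R_infinity_def)
  with assms(3) show False by contradiction
qed

end
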